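(* Let $\mathrm{W}$ be a twice continuously differentiable elastic energy, written as a function of the Green-Lagrange strain $E=\tfrac12(F^TF-\mathbb 1)$, and let the material be hyperelastic, i.e. the second Piola-Kirchhoff stress is $S_2(E)=\mathrm{D}_E\mathrm{W}(E)\in\mathrm{Sym}(3)$ and the Kirchhoff stress is $\tau=F\,S_2(E)\,F^T$. (No isotropy is assumed.) Fix $F\in\mathrm{GL}^+(3)$, put $J=\det F$, and let $\mathbb H^{\mathrm{ZJ}}_\tau(\tau):\mathrm{Sym}(3)\to\mathrm{Sym}(3)$ be the induced Kirchhoff tangent stiffness tensor at $F$ associated with the Zaremba-Jaumann rate, i.e. the linear map determined by $$\frac{\mathrm{D}^{\mathrm{ZJ}}}{\mathrm{D}t}[\tau]=\mathbb H^{\mathrm{ZJ}}_\tau(\tau).D$$ for every motion passing through the deformation gradient $F$. Then $\mathbb H^{\mathrm{ZJ}}_\tau(\tau)$ is major symmetric, $$\langle \mathbb H^{\mathrm{ZJ}}_\tau(\tau).D_1,D_2\rangle=\langle \mathbb H^{\mathrm{ZJ}}_\tau(\tau).D_2,D_1\rangle\qquad\text{for all }D_1,D_2\in\mathrm{Sym}(3),$$ and $\mathbb D:=\frac1J\,\mathbb H^{\mathrm{ZJ}}_\tau(\tau)\in\mathrm{Sym}_4(6)$.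
   Context: $\mathrm{Sym}(3)$ is the space of real symmetric $3\times3$ matrices, $\langle X,Y\rangle=\mathrm{tr}(XY^T)$, $\mathbb 1$ is the identity matrix, $\mathrm{GL}^+(3)$ is the group of real $3\times 3$ matrices with positive determinant. The energy $\mathrm{W}$ is defined on the open set of $E\in\mathrm{Sym}(3)$ with $\mathbb 1+2E$ positive definite; $\mathrm{D}_E$ denotes the Fréchet derivative with respect to $E$ (gradient with respect to $\langle\cdot,\cdot\rangle$ for scalar functions). A motion is represented at a material point by a $C^1$ curve $t\mapsto F(t)\in\mathrm{GL}^+(3)$; it passes through a given $F$ if it takes this value at the time under consideration. A dot or $\frac{\mathrm D}{\mathrm Dt}$ denotes the derivative along the curve (material time derivative). $L=\dot F F^{-1}$ is the velocity gradient, $D=\tfrac12(L+L^T)$ the rate of deformation, $W=\tfrac12(L-L^T)$ the vorticity (not to be confused with the energy $\mathrm W$). The Zaremba-Jaumann rate of $\tau$ is $$\frac{\mathrm{D}^{\mathrm{ZJ}}}{\mathrm{D}t}[\tau]=\frac{\mathrm D}{\mathrm Dt}[\tau]+\tau W-W\tau .$$ $\mathbb T.Z$ denotes the action of a linear map (fourth-order tensor) $\mathbb T$ on a matrix $Z$. $\mathrm{Sym}_4(6)$ is the set of fourth-order tensors that are minor and major symmetric, i.e. of self-adjoint linear maps $\mathrm{Sym}(3)\to\mathrm{Sym}(3)$ with respect to $\langle\cdot,\cdot\rangle$ (identified with symmetric $6\times 6$ matrices). *)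

theory Defs
  imports "HOL-Analysis.Analysis"
begin

type_synonym mat3 = "real ^ 3 ^ 3"

definition Sym3 :: "mat3 set" where
  "Sym3 = {X. transpose X = X}"

definition GL_pos :: "mat3 set" where
  "GL_pos = {F. det F > 0}"

definition frob :: "mat3 \<Rightarrow> mat3 \<Rightarrow> real" where
  "frob X Y = trace (X ** transpose Y)"

lemma frob_eq_inner: "frob X Y = X \<bullet> Y"
  by (simp add: frob_def trace_def matrix_matrix_mult_def transpose_def inner_vec_def)

definition strain_domain :: "mat3 set" where
  "strain_domain = {E \<in> Sym3. \<forall>x. x \<noteq> 0 \<longrightarrow> x \<bullet> ((mat 1 + 2 *\<^sub>R E) *v x) > 0}"

text \<open>
  The energy is only meaningful on \<open>strain_domain\<close>, which is relatively open in the subspace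
  \<open>Sym3\<close>; every derivative with respect to \<open>E\<close> is therefore taken within \<open>strain_domain\<close>. Such
  a derivative is a linear map on all matrices of which only the restriction to \<open>Sym3\<close> is
  determined. This is harmless in the existential definition of twice continuous
  differentiability: composing with the projection onto \<open>Sym3\<close> turns derivatives on \<open>Sym3\<close> into
  witnesses, and restricting witnesses to \<open>Sym3\<close> gives back the derivatives. The gradient is made
  unique by requiring it to lie in \<open>Sym3\<close>.
\<close>

definition C2_energy :: "(mat3 \<Rightarrow> real) \<Rightarrow> bool" where
  "C2_energy W \<longleftrightarrow>
    (\<exists>(W' :: mat3 \<Rightarrow> (mat3 \<Rightarrow>\<^sub>L real)) (W'' :: mat3 \<Rightarrow> (mat3 \<Rightarrow>\<^sub>L (mat3 \<Rightarrow>\<^sub>L real))).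
      (\<forall>E\<in>strain_domain. (W has_derivative blinfun_apply (W' E)) (at E within strain_domain)) \<and>
      (\<forall>E\<in>strain_domain. (W' has_derivative blinfun_apply (W'' E)) (at E within strain_domain)) \<and>
      continuous_on strain_domain W'')"

definition PK2_stress :: "(mat3 \<Rightarrow> real) \<Rightarrow> mat3 \<Rightarrow> mat3" where
  "PK2_stress W E =
    (THE S. S \<in> Sym3 \<and> (W has_derivative (\<lambda>H. frob S H)) (at E within strain_domain))"

definition green_lagrange :: "mat3 \<Rightarrow> mat3" where
  "green_lagrange F = (1/2) *\<^sub>R (transpose F ** F - mat 1)"

definition kirchhoff :: "(mat3 \<Rightarrow> real) \<Rightarrow> mat3 \<Rightarrow> mat3" where
  "kirchhoff W F = F ** PK2_stress W (green_lagrange F) ** transpose F"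

definition motion :: "real set \<Rightarrow> (real \<Rightarrow> mat3) \<Rightarrow> bool" where
  "motion I \<phi> \<longleftrightarrow> open I \<and> is_interval I \<and> \<phi> C1_differentiable_on I \<and> (\<forall>t\<in>I. \<phi> t \<in> GL_pos)"

definition velocity_gradient :: "(real \<Rightarrow> mat3) \<Rightarrow> real \<Rightarrow> mat3" where
  "velocity_gradient \<phi> t = vector_derivative \<phi> (at t) ** matrix_inv (\<phi> t)"

definition rate_of_deformation :: "(real \<Rightarrow> mat3) \<Rightarrow> real \<Rightarrow> mat3" where
  "rate_of_deformation \<phi> t =
    (1/2) *\<^sub>R (velocity_gradient \<phi> t + transpose (velocity_gradient \<phi> t))"

definition vorticity :: "(real \<Rightarrow> mat3) \<Rightarrow> real \<Rightarrow> mat3" where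
  "vorticity \<phi> t =
    (1/2) *\<^sub>R (velocity_gradient \<phi> t - transpose (velocity_gradient \<phi> t))"

definition ZJ_rate :: "(real \<Rightarrow> mat3) \<Rightarrow> (real \<Rightarrow> mat3) \<Rightarrow> real \<Rightarrow> mat3" where
  "ZJ_rate \<phi> \<tau> t =
    vector_derivative \<tau> (at t) + \<tau> t ** vorticity \<phi> t - vorticity \<phi> t ** \<tau> t"

text \<open>
  A linear map from \<open>Sym3\<close> to \<open>Sym3\<close> is encoded as a minor symmetric fourth-order tensor, i.e.
  as the linear map \<open>T\<close> on all matrices with values in \<open>Sym3\<close> that ignores the skew-symmetric part
  of its argument (in components, \<open>T\<^sub>i\<^sub>j\<^sub>k\<^sub>l = T\<^sub>j\<^sub>i\<^sub>k\<^sub>l = T\<^sub>i\<^sub>j\<^sub>l\<^sub>k\<close>). Restriction to \<open>Sym3\<close> is a bijection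
  between these tensors and the linear maps from \<open>Sym3\<close> to \<open>Sym3\<close>, so that each such linear map
  is represented by exactly one HOL function.
\<close>

definition minor_symmetric :: "(mat3 \<Rightarrow> mat3) \<Rightarrow> bool" where
  "minor_symmetric T \<longleftrightarrow> linear T \<and> (\<forall>X. T X \<in> Sym3) \<and> (\<forall>X. T (transpose X) = T X)"

definition major_symmetric :: "(mat3 \<Rightarrow> mat3) \<Rightarrow> bool" where
  "major_symmetric T \<longleftrightarrow> (\<forall>X\<in>Sym3. \<forall>Y\<in>Sym3. frob (T X) Y = frob (T Y) X)"

definition Sym4_6 :: "(mat3 \<Rightarrow> mat3) set" where
  "Sym4_6 = {T. minor_symmetric T \<and> major_symmetric T}"

definition ZJ_stiffness :: "(mat3 \<Rightarrow> real) \<Rightarrow> mat3 \<Rightarrow> (mat3 \<Rightarrow> mat3)" where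
  "ZJ_stiffness W F = (THE H. minor_symmetric H \<and>
    (\<forall>I \<phi> t. motion I \<phi> \<and> t \<in> I \<and> \<phi> t = F \<longrightarrow>
      ZJ_rate \<phi> (\<lambda>s. kirchhoff W (\<phi> s)) t = H (rate_of_deformation \<phi> t)))"

end

theory Submission
  imports Defs
begin

text \<open>
  Along a motion through \<open>F\<close> with \<open>L = D + Q\<close> (\<open>Q\<close> the vorticity), the strain rate is \<open>F\<^sup>T D F\<close>. Differentiating
  \<open>\<tau> = F S\<^sub>2 F\<^sup>T\<close> gives \<open>L \<tau> + \<tau> L\<^sup>T + F A(F\<^sup>T D F) F\<^sup>T\<close>, where \<open>A\<close> is the second derivative of the
  energy, and the vorticity terms of the Zaremba-Jaumann rate cancel those of \<open>L\<close>. Hence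
  \<open>H D = D \<tau> + \<tau> D + F A(F\<^sup>T D F) F\<^sup>T\<close>, which is self-adjoint because \<open>\<tau>\<close> is symmetric and \<open>A\<close> is
  self-adjoint by the symmetry of second derivatives. The rate determines \<open>H\<close> since the motions
  \<open>(1 + s D) F\<close> realise every symmetric \<open>D\<close>.

  To work on an open set of matrices, the energy is precomposed with the projection onto the
  symmetric matrices.
\<close>

section \<open>Symmetric part, and symmetry of second derivatives\<close>

definition sym_part :: "real^'n^'n \<Rightarrow> real^'n^'n" where
  "sym_part X = (1/2) *\<^sub>R (X + transpose X)"

lemma bounded_bilinear_matrix_matrix_mult:
  "bounded_bilinear ((**) :: real^'n^'m \<Rightarrow> real^'p^'n \<Rightarrow> real^'p^'m)"
  unfolding bilinear_conv_bounded_bilinear[symmetric] bilinear_def linear_iff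
  by (auto simp: matrix_matrix_mult_def vec_eq_iff sum.distrib sum_distrib_left algebra_simps)

lemma bounded_linear_transpose: "bounded_linear (transpose :: real^'n^'m \<Rightarrow> real^'m^'n)"
  unfolding linear_conv_bounded_linear[symmetric] linear_iff
  by (auto simp: transpose_def vec_eq_iff)

text \<open>
  The second difference \<open>\<Delta> t\<close> is symmetric in \<open>h\<close> and \<open>k\<close>; by the mean value theorem it equals
  \<open>t\<^sup>2 f''(k) h + o(t\<^sup>2)\<close>.
\<close>
lemma second_derivative_symmetric:
  fixes f :: "'a::real_normed_vector \<Rightarrow> real" and f' :: "'a \<Rightarrow> 'a \<Rightarrow>\<^sub>L real"
  assumes "open S" "a \<in> S"
    and f: "\<And>x. x \<in> S \<Longrightarrow> (f has_derivative f' x) (at x)"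
    and f': "(f' has_derivative f'') (at a)"
  shows "f'' h k = f'' k h"
proof -
  interpret f'': bounded_linear f''
    using f' by (rule has_derivative_bounded_linear)
  define \<Delta> where "\<Delta> t = f (a + t *\<^sub>R h + t *\<^sub>R k) - f (a + t *\<^sub>R h) - f (a + t *\<^sub>R k) + f a" for t
  \<comment> \<open>The summand 1 keeps \<open>M\<close> positive even if \<open>h\<close> and
    \<open>k\<close> both vanish.\<close>
  define M where "M = norm h + norm k + 1"
  have "M > 0" by (simp add: M_def add_nonneg_pos)
  \<comment> \<open>Stated for arbitrary \<open>u\<close>, \<open>v\<close>, so that it applies to
    both orders of \<open>h\<close> and \<open>k\<close>. The bound collects two remainders of
    \<open>f'\<close>, each at most \<open>e * (t * M)\<close>, tested on a vector of norm at most
    \<open>M\<close> and multiplied by \<open>t\<close>.\<close>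
  have near: "\<bar>f (a + t *\<^sub>R u + t *\<^sub>R v) - f (a + t *\<^sub>R u) - f (a + t *\<^sub>R v) + f a - t\<^sup>2 * f'' v u\<bar>
      \<le> 2 * e * M\<^sup>2 * t\<^sup>2"
    if d: "\<And>y. norm y < d \<Longrightarrow> a + y \<in> S \<and> norm (f' (a + y) - f' a - f'' y) \<le> e * norm y"
      and t: "0 < t" "t * M < d" and uv: "norm u + norm v \<le> M" and "e > 0" for d e t u v
  proof -
    \<comment> \<open>The second difference is the increment of this function over
      \<open>[0, t]\<close>, so one mean value step in direction \<open>u\<close> expresses it
      through \<open>f'\<close>.\<close>
    define \<phi> where "\<phi> s = f (a + s *\<^sub>R u + t *\<^sub>R v) - f (a + s *\<^sub>R u)" for s
    have small: "norm (s *\<^sub>R u + t *\<^sub>R v) \<le> t * M" "norm (s *\<^sub>R u) \<le> t * M" if "0 \<le> s" "s \<le> t" for s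
    proof -
      have "norm (s *\<^sub>R u + t *\<^sub>R v) \<le> s * norm u + t * norm v"
        using norm_triangle_ineq[of "s *\<^sub>R u" "t *\<^sub>R v"] that t by simp
      moreover have su: "s * norm u \<le> t * norm u" using that by (simp add: mult_right_mono)
      moreover have tM: "t * (norm u + norm v) \<le> t * M" using uv t by simp
      ultimately show "norm (s *\<^sub>R u + t *\<^sub>R v) \<le> t * M" by (simp add: distrib_left)
      have "0 \<le> t * norm v" using t by simp
      then show "norm (s *\<^sub>R u) \<le> t * M" using su tM that unfolding distrib_left norm_scaleR by linarith
    qed
    have inS: "a + s *\<^sub>R u + t *\<^sub>R v \<in> S" "a + s *\<^sub>R u \<in> S" if "0 \<le> s" "s \<le> t" for s
      using d[of "s *\<^sub>R u + t *\<^sub>R v"] d[of "s *\<^sub>R u"] small[OF that] t by (auto simp: add.assoc)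
    have der: "(\<phi> has_derivative (\<lambda>r. f' (a + s *\<^sub>R u + t *\<^sub>R v) (r *\<^sub>R u) - f' (a + s *\<^sub>R u) (r *\<^sub>R u)))
        (at s within {0..t})" if "0 \<le> s" "s \<le> t" for s
    proof -
      have 1: "((\<lambda>s. a + s *\<^sub>R u + t *\<^sub>R v) has_derivative (\<lambda>r. r *\<^sub>R u)) (at s)"
        "((\<lambda>s. a + s *\<^sub>R u) has_derivative (\<lambda>r. r *\<^sub>R u)) (at s)"
        by (auto intro!: derivative_eq_intros)
      have "((\<lambda>s. f (a + s *\<^sub>R u + t *\<^sub>R v)) has_derivative
          (\<lambda>r. f' (a + s *\<^sub>R u + t *\<^sub>R v) (r *\<^sub>R u))) (at s)"
        using has_derivative_compose[OF 1(1) f[OF inS(1)[OF that]]] .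
      moreover have "((\<lambda>s. f (a + s *\<^sub>R u)) has_derivative (\<lambda>r. f' (a + s *\<^sub>R u) (r *\<^sub>R u))) (at s)"
        using has_derivative_compose[OF 1(2) f[OF inS(2)[OF that]]] .
      ultimately show ?thesis
        unfolding \<phi>_def by (rule has_derivative_at_withinI[OF has_derivative_diff])
    qed
    from mvt_simple[OF \<open>0 < t\<close> der]
    obtain \<xi> where \<xi>: "\<xi> \<in> {0<..<t}"
      and eq: "\<phi> t - \<phi> 0 = f' (a + \<xi> *\<^sub>R u + t *\<^sub>R v) (t *\<^sub>R u) - f' (a + \<xi> *\<^sub>R u) (t *\<^sub>R u)" by auto
    let ?y = "\<xi> *\<^sub>R u + t *\<^sub>R v" and ?z = "\<xi> *\<^sub>R u"
    \<comment> \<open>Errors of the linearisation of \<open>f'\<close> at the two intermediate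
      points. Since \<open>?y - ?z = t *\<^sub>R v\<close>, the unknown point \<xi> drops out of the
      linear parts, which leave exactly \<open>t *\<^sub>R f'' v\<close>.\<close>
    let ?R = "(f' (a + ?y) - f' a - f'' ?y) - (f' (a + ?z) - f' a - f'' ?z)"
    have yz: "norm ?y \<le> t * M" "norm ?z \<le> t * M" using small \<xi> by auto
    have "norm ?R \<le> e * norm ?y + e * norm ?z"
      using d[of ?y] d[of ?z] yz t norm_triangle_ineq4[of "f' (a + ?y) - f' a - f'' ?y" "f' (a + ?z) - f' a - f'' ?z"]
      by linarith
    also have "\<dots> \<le> 2 * e * (t * M)"
      using mult_left_mono[OF yz(1), of e] mult_left_mono[OF yz(2), of e] \<open>e > 0\<close> unfolding mult.assoc by linarith
    finally have R: "norm ?R \<le> 2 * e * (t * M)" .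
    have "\<phi> t - \<phi> 0 - t\<^sup>2 * f'' v u = t * ?R u"
      unfolding eq
      by (simp add: f''.add f''.scaleR blinfun.diff_left blinfun.add_left blinfun.scaleR_left
          blinfun.scaleR_right algebra_simps power2_eq_square)
    also have "\<bar>\<dots>\<bar> \<le> t * (norm ?R * norm u)"
      using norm_blinfun[of ?R u] t by (simp add: abs_mult)
    also have "\<dots> \<le> t * ((2 * e * (t * M)) * M)"
      using R t uv norm_ge_zero[of v] \<open>M > 0\<close> \<open>e > 0\<close>
      by (intro mult_left_mono mult_mono) (auto intro: order_trans[OF _ uv])
    finally show ?thesis
      by (simp add: \<phi>_def power2_eq_square algebra_simps)
  qed
  have "\<bar>f'' h k - f'' k h\<bar> \<le> e" if "e > 0" for e
  proof -
    \<comment> \<open>Chosen so that the errors of the two orders,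
      \<open>2 * e' * M\<^sup>2 * t\<^sup>2\<close> each, add up to
      \<open>t\<^sup>2 * e\<close>.\<close>
    define e' where "e' = e / (4 * M\<^sup>2)"
    have e': "e' > 0" using that \<open>M > 0\<close> by (simp add: e'_def)
    obtain d1 where d1: "d1 > 0" "\<And>y. norm (y - a) < d1 \<Longrightarrow> norm (f' y - f' a - f'' (y - a)) \<le> e' * norm (y - a)"
      using f' e' unfolding has_derivative_at_alt by blast
    obtain d2 where d2: "d2 > 0" "ball a d2 \<subseteq> S"
      using assms(1,2) openE by blast
    define d where "d = min d1 d2"
    have d: "a + y \<in> S \<and> norm (f' (a + y) - f' a - f'' y) \<le> e' * norm y" if "norm y < d" for y
      using d1(2)[of "a + y"] d2(2) that by (auto simp: d_def dist_norm subset_iff)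
    define t where "t = d / (2 * M)"
    have t: "0 < t" "t * M < d"
      using \<open>M > 0\<close> d1 d2 by (auto simp: t_def d_def)
    have "\<bar>\<Delta> t - t\<^sup>2 * f'' k h\<bar> \<le> 2 * e' * M\<^sup>2 * t\<^sup>2"
      using near[OF d t, of h k] e' unfolding \<Delta>_def M_def by simp
    moreover have "\<bar>\<Delta> t - t\<^sup>2 * f'' h k\<bar> \<le> 2 * e' * M\<^sup>2 * t\<^sup>2"
      using near[OF d t, of k h] e' unfolding \<Delta>_def M_def by (simp add: algebra_simps)
    ultimately have "\<bar>t\<^sup>2 * f'' h k - t\<^sup>2 * f'' k h\<bar> \<le> 4 * e' * M\<^sup>2 * t\<^sup>2" by linarith
    also have "\<dots> = t\<^sup>2 * e" using \<open>M > 0\<close> by (simp add: e'_def field_simps)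
    finally have "t\<^sup>2 * \<bar>f'' h k - f'' k h\<bar> \<le> t\<^sup>2 * e"
      by (simp add: abs_mult flip: right_diff_distrib)
    then show ?thesis using t by simp
  qed
  then have "\<bar>f'' h k - f'' k h\<bar> \<le> 0"
    by (rule field_le_epsilon) simp
  then show ?thesis by simp
qed

section \<open>Matrix algebra and adjoints for the Frobenius product\<close>

lemmas matrix_mult_distribs =
  bounded_bilinear.add_left[OF bounded_bilinear_matrix_matrix_mult]
  bounded_bilinear.add_right[OF bounded_bilinear_matrix_matrix_mult]
  bounded_bilinear.diff_left[OF bounded_bilinear_matrix_matrix_mult]
  bounded_bilinear.diff_right[OF bounded_bilinear_matrix_matrix_mult]
  bounded_bilinear.scaleR_left[OF bounded_bilinear_matrix_matrix_mult]
  bounded_bilinear.scaleR_right[OF bounded_bilinear_matrix_matrix_mult]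

lemma bounded_bilinear_matrix_vector_mult:
  "bounded_bilinear ((*v) :: real^'n^'m \<Rightarrow> real^'n \<Rightarrow> real^'m)"
  unfolding bilinear_conv_bounded_bilinear[symmetric] bilinear_def linear_iff
  by (auto simp: matrix_vector_mult_def vec_eq_iff sum.distrib sum_distrib_left algebra_simps)

lemmas transpose_linear_simps =
  linear_add[OF bounded_linear.linear[OF bounded_linear_transpose]]
  linear_diff[OF bounded_linear.linear[OF bounded_linear_transpose]]
  linear_scale[OF bounded_linear.linear[OF bounded_linear_transpose]]

lemma bounded_linear_sym_part: "bounded_linear (sym_part :: real^'n^'n \<Rightarrow> _)"
  unfolding sym_part_def
  by (intro bounded_linear_const_scaleR bounded_linear_add bounded_linear_ident bounded_linear_transpose)

lemma sym_part_transpose [simp]: "sym_part (transpose X) = sym_part X"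
  by (simp add: sym_part_def add.commute)

lemma transpose_sym_part [simp]: "transpose (sym_part X) = sym_part X"
  by (simp add: sym_part_def transpose_linear_simps add.commute)

lemma sym_part_in_Sym3 [simp]: "sym_part X \<in> Sym3"
  by (simp add: Sym3_def)

lemma sym_part_Sym3 [simp]: "X \<in> Sym3 \<Longrightarrow> sym_part X = X"
  by (simp add: Sym3_def sym_part_def flip: scaleR_2)

lemma inner_transpose: "transpose X \<bullet> Y = X \<bullet> transpose (Y :: real^'n^'m)"
proof -
  have "transpose X \<bullet> Y = (\<Sum>i\<in>UNIV. \<Sum>j\<in>UNIV. X $ j $ i * Y $ i $ j)"
    by (simp add: inner_vec_def transpose_def)
  also have "\<dots> = (\<Sum>j\<in>UNIV. \<Sum>i\<in>UNIV. X $ j $ i * Y $ i $ j)"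
    by (rule sum.swap)
  finally show ?thesis
    by (simp add: inner_vec_def transpose_def)
qed

lemma inner_matrix_mult_left: "(A ** X) \<bullet> Y = X \<bullet> (transpose A ** (Y :: real^'p^'m))"
proof -
  have "(A ** X) \<bullet> Y = (\<Sum>i\<in>UNIV. \<Sum>j\<in>UNIV. \<Sum>k\<in>UNIV. A $ i $ k * X $ k $ j * Y $ i $ j)"
    by (simp add: inner_vec_def matrix_matrix_mult_def sum_distrib_right)
  also have "\<dots> = (\<Sum>i\<in>UNIV. \<Sum>k\<in>UNIV. \<Sum>j\<in>UNIV. A $ i $ k * X $ k $ j * Y $ i $ j)"
    by (intro sum.cong refl sum.swap)
  also have "\<dots> = (\<Sum>k\<in>UNIV. \<Sum>i\<in>UNIV. \<Sum>j\<in>UNIV. A $ i $ k * X $ k $ j * Y $ i $ j)"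
    by (rule sum.swap)
  also have "\<dots> = (\<Sum>k\<in>UNIV. \<Sum>j\<in>UNIV. \<Sum>i\<in>UNIV. A $ i $ k * X $ k $ j * Y $ i $ j)"
    by (intro sum.cong refl sum.swap)
  finally show ?thesis
    by (simp add: inner_vec_def matrix_matrix_mult_def transpose_def sum_distrib_left mult_ac)
qed

lemma inner_matrix_mult_right: "(X ** A) \<bullet> Y = X \<bullet> (Y ** transpose (A :: real^'p^'n))"
proof -
  \<comment> \<open>Transposing turns right multiplication into left multiplication, whose adjoint
    is known.\<close>
  have "(X ** A) \<bullet> Y = transpose (transpose A ** transpose X) \<bullet> Y"
    by (simp add: matrix_transpose_mul)
  also have "\<dots> = (transpose A ** transpose X) \<bullet> transpose Y"
    by (rule inner_transpose)
  also have "\<dots> = transpose X \<bullet> (A ** transpose Y)"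
    by (simp add: inner_matrix_mult_left)
  also have "\<dots> = X \<bullet> (Y ** transpose A)"
    by (simp add: inner_transpose matrix_transpose_mul)
  finally show ?thesis .
qed

lemma
  fixes A :: "'a::semiring_1^'n^'m"
  assumes "invertible A"
  shows matrix_inv_right: "A ** matrix_inv A = mat 1"
    and matrix_inv_left: "matrix_inv A ** A = mat 1"
  using someI_ex[OF assms[unfolded invertible_def]] by (simp_all add: matrix_inv_def)

lemma GL_pos_invertible: "F \<in> GL_pos \<Longrightarrow> invertible F"
  by (simp add: GL_pos_def invertible_det_nz)

lemma continuous_on_det:
  fixes f :: "'a::topological_space \<Rightarrow> real^'n^'n"
  shows "continuous_on S f \<Longrightarrow> continuous_on S (\<lambda>x. det (f x))"
  unfolding det_def by (intro continuous_intros)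

section \<open>The domain of admissible strains\<close>

text \<open>Failure of positive definiteness is witnessed by a unit vector, so the complement is the
  projection of a closed set along the compact unit sphere, hence closed.\<close>

lemma open_sym_part_strain_domain: "open {X. sym_part X \<in> strain_domain}"
proof -
  let ?q = "\<lambda>(x, X). x \<bullet> ((mat 1 + 2 *\<^sub>R sym_part X) *v x)"
  have "continuous_on UNIV ?q"
    unfolding case_prod_beta
    by (intro continuous_intros bounded_bilinear.continuous_on[OF bounded_bilinear_matrix_vector_mult]
        bounded_linear.continuous_on[OF bounded_linear_sym_part])
  then have "closed {p. ?q p \<le> 0}"
    by (intro closed_Collect_le continuous_on_const)
  then have "closed {X. \<exists>x. x \<in> sphere 0 1 \<and> (x, X) \<in> {p. ?q p \<le> 0}}"
    by (intro closed_compact_projection compact_sphere)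
  also have "{X. \<exists>x. x \<in> sphere 0 1 \<and> (x, X) \<in> {p. ?q p \<le> 0}} = - {X. sym_part X \<in> strain_domain}"
    (is "?L = ?R")
  proof
    show "?L \<subseteq> ?R"
    proof
      fix X assume "X \<in> ?L"
      then obtain x where x: "norm x = 1" "?q (x, X) \<le> 0" by auto
      then have "x \<noteq> 0" by auto
      then show "X \<in> ?R" using x by (auto simp: strain_domain_def not_less[symmetric])
    qed
    show "?R \<subseteq> ?L"
    proof
      fix X assume "X \<in> ?R"
      then obtain x where x: "x \<noteq> 0" "?q (x, X) \<le> 0"
        by (auto simp: strain_domain_def not_less)
      \<comment> \<open>The quadratic form is homogeneous of degree two, so a witness can be
        normalised without changing the sign.\<close>
      define r where "r = inverse (norm x)"
      have "?q (r *\<^sub>R x, X) = r\<^sup>2 * ?q (x, X)"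
        by (simp add: matrix_vector_mult_scaleR power2_eq_square)
      moreover have "r\<^sup>2 * ?q (x, X) \<le> 0"
        using x(2) by (intro mult_nonneg_nonpos) auto
      ultimately have "?q (r *\<^sub>R x, X) \<le> 0" by simp
      moreover have "norm (r *\<^sub>R x) = 1"
        using x(1) by (simp add: r_def)
      ultimately show "X \<in> ?L" by (intro CollectI exI[of _ "r *\<^sub>R x"]) auto
    qed
  qed
  finally show ?thesis by (simp add: open_closed)
qed

lemma green_lagrange_in_Sym3: "green_lagrange F \<in> Sym3"
  by (simp add: Sym3_def green_lagrange_def transpose_linear_simps matrix_transpose_mul)

text \<open>The matrix in question is \<open>transpose F ** F\<close>, whose quadratic form is the
  squared length of \<open>F *v x\<close>; this is positive because \<open>F\<close> is
  injective.\<close>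

lemma green_lagrange_in_strain_domain:
  assumes "F \<in> GL_pos"
  shows "green_lagrange F \<in> strain_domain"
proof -
  have "x \<bullet> ((mat 1 + 2 *\<^sub>R green_lagrange F) *v x) > 0" if "x \<noteq> 0" for x
  proof -
    have "invertible F"
      using assms by (rule GL_pos_invertible)
    then have "F *v x \<noteq> 0"
      using that by (metis inj_matrix_vector_mult injD matrix_vector_mult_0_right)
    moreover have "mat 1 + 2 *\<^sub>R green_lagrange F = transpose F ** F"
      by (simp add: green_lagrange_def)
    moreover have "x \<bullet> ((transpose F ** F) *v x) = (F *v x) \<bullet> (F *v x)"
      by (metis dot_lmul_matrix matrix_vector_mul_assoc vector_transpose_matrix transpose_transpose)
    ultimately show ?thesis by simp
  qed
  then show ?thesis
    by (simp add: strain_domain_def green_lagrange_in_Sym3)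
qed

section \<open>The second Piola-Kirchhoff stress as a differentiable gradient\<close>

text \<open>The Riesz representative of a functional, used to turn derivatives into gradients. The
  basis expansion makes its linearity in \<open>L\<close> evident.\<close>

definition riesz :: "('a::euclidean_space \<Rightarrow>\<^sub>L real) \<Rightarrow> 'a" where
  "riesz L = (\<Sum>b\<in>Basis. L b *\<^sub>R b)"

lemma inner_riesz [simp]: "riesz L \<bullet> x = L x"
proof -
  have "L x = L (\<Sum>b\<in>Basis. (x \<bullet> b) *\<^sub>R b)"
    by (simp add: euclidean_representation)
  also have "\<dots> = (\<Sum>b\<in>Basis. (x \<bullet> b) * L b)"
    by (simp add: blinfun.sum_right blinfun.scaleR_right)
  finally show ?thesis
    by (simp add: riesz_def inner_sum_left inner_commute[of x] mult.commute)
qed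

lemma bounded_linear_riesz: "bounded_linear riesz"
  unfolding riesz_def
  by (intro bounded_linear_sum bounded_linear_scaleR_left[THEN bounded_linear_compose]
      blinfun.bounded_linear_left)

text \<open>The stress is the Riesz representative of the derivative \<open>f'\<close> of the
  projected energy, so its derivative \<open>A\<close> represents \<open>f''\<close>. Values lie in
  \<open>Sym3\<close> because these functionals ignore skew parts; \<open>A\<close> is self-adjoint
  because \<open>f''\<close> is symmetric.\<close>

lemma PK2_stress_derivative:
  assumes "C2_energy W" "E \<in> strain_domain"
  obtains A where
    "((\<lambda>X. PK2_stress W (sym_part X)) has_derivative A) (at E)"
    "\<And>X. A X \<in> Sym3"
    "\<And>X Y. A X \<bullet> Y = A Y \<bullet> X"
    "PK2_stress W E \<in> Sym3"
proof -
  obtain W' :: "mat3 \<Rightarrow> (mat3 \<Rightarrow>\<^sub>L real)" and W'' :: "mat3 \<Rightarrow> (mat3 \<Rightarrow>\<^sub>L (mat3 \<Rightarrow>\<^sub>L real))"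
    where W': "\<And>E. E \<in> strain_domain \<Longrightarrow> (W has_derivative W' E) (at E within strain_domain)"
      and W'': "\<And>E. E \<in> strain_domain \<Longrightarrow> (W' has_derivative W'' E) (at E within strain_domain)"
    using assms(1) unfolding C2_energy_def by blast
  define U where "U = {X. sym_part X \<in> strain_domain}"
  have "open U" unfolding U_def by (rule open_sym_part_strain_domain)
  have sub: "strain_domain \<subseteq> U" by (auto simp: U_def strain_domain_def)
  \<comment> \<open>With the projection as a bounded operator, composing with \<open>P\<close> is a
    bounded linear map between operator spaces, so the derivative of \<open>f'\<close> follows by
    linearity.\<close>
  define P where "P = Blinfun (sym_part :: mat3 \<Rightarrow> mat3)"
  have P [simp]: "blinfun_apply P X = sym_part X" for X
    unfolding P_def by (simp add: bounded_linear_Blinfun_apply bounded_linear_sym_part)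
  define f' where "f' X = W' (sym_part X) o\<^sub>L P" for X
  define f'' where "f'' H = W'' E (sym_part H) o\<^sub>L P" for H
  \<comment> \<open>Chain rule turning a derivative within \<open>strain_domain\<close> into a full
    one: \<open>sym_part\<close> maps the open set \<open>U\<close> into
    \<open>strain_domain\<close>.\<close>
  have compose: "((\<lambda>X. g (sym_part X)) has_derivative (\<lambda>H. g' (sym_part H))) (at X)"
    if "(g has_derivative g') (at (sym_part X) within strain_domain)" "X \<in> U"
    for g :: "mat3 \<Rightarrow> 'b::real_normed_vector" and g' X
  proof -
    have "sym_part ` U \<subseteq> strain_domain" by (auto simp: U_def)
    then have "(g has_derivative g') (at (sym_part X) within sym_part ` U)"
      by (rule has_derivative_subset[OF that(1)])
    then have "((\<lambda>X. g (sym_part X)) has_derivative (\<lambda>H. g' (sym_part H))) (at X within U)"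
      by (rule has_derivative_in_compose[OF bounded_linear_imp_has_derivative[OF bounded_linear_sym_part]])
    then show ?thesis unfolding at_within_open[OF that(2) \<open>open U\<close>] .
  qed
  have f: "((\<lambda>X. W (sym_part X)) has_derivative f' X) (at X)" if "X \<in> U" for X
    using compose[OF W'[of "sym_part X"] that] that
    by (simp add: f'_def U_def blinfun_compose.rep_eq o_def)
  have "E \<in> U" and [simp]: "sym_part E = E"
    using assms(2) by (auto simp: U_def strain_domain_def)
  have f': "(f' has_derivative f'') (at E)"
  proof -
    have "((\<lambda>X. W' (sym_part X)) has_derivative (\<lambda>H. W'' E (sym_part H))) (at E)"
      using W''[OF assms(2)] \<open>E \<in> U\<close> by (intro compose) simp_all
    then show ?thesis
      unfolding f'_def f''_def
      by (rule bounded_linear.has_derivative[OF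
            bounded_bilinear.bounded_linear_left[OF bounded_bilinear_blinfun_compose]])
  qed
  have sym3: "riesz L \<in> Sym3" if "\<And>H. L (transpose H) = L H" for L :: "mat3 \<Rightarrow>\<^sub>L real"
  proof -
    have "\<forall>H. transpose (riesz L) \<bullet> H = riesz L \<bullet> H"
      using that by (simp add: inner_transpose)
    then show ?thesis
      unfolding Sym3_def mem_Collect_eq by (simp only: vector_eq_rdot)
  qed
  have f'_Sym3: "riesz (f' X) \<in> Sym3" for X
    by (rule sym3) (simp add: f'_def)
  have PK2: "PK2_stress W X = riesz (f' X)" if X: "X \<in> strain_domain" for X
    unfolding PK2_stress_def
  proof (rule the_equality)
    have "X \<in> U" using X sub by auto
    have "((\<lambda>X. W (sym_part X)) has_derivative f' X) (at X within strain_domain)"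
      using f \<open>X \<in> U\<close> has_derivative_at_withinI by blast
    then have "(W has_derivative f' X) (at X within strain_domain)"
      by (rule has_derivative_transform[rotated 2]) (use X in \<open>auto simp: strain_domain_def\<close>)
    moreover have "frob (riesz (f' X)) = blinfun_apply (f' X)"
      by (simp add: fun_eq_iff frob_eq_inner)
    ultimately show "riesz (f' X) \<in> Sym3 \<and> (W has_derivative frob (riesz (f' X))) (at X within strain_domain)"
      using f'_Sym3 by simp
  next
    have "X \<in> U" "sym_part X = X" using X sub by (auto simp: strain_domain_def)
    fix S assume S: "S \<in> Sym3 \<and> (W has_derivative frob S) (at X within strain_domain)"
    \<comment> \<open>Derivatives at a point of the open set \<open>U\<close> are unique, so any
      competitor \<open>S\<close> acts like \<open>f' X\<close> once skew parts are projected
      away.\<close>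
    have "((\<lambda>X. W (sym_part X)) has_derivative (\<lambda>H. frob S (sym_part H))) (at X)"
      using S \<open>X \<in> U\<close> \<open>sym_part X = X\<close> by (intro compose) simp_all
    then have eq: "blinfun_apply (f' X) = (\<lambda>H. frob S (sym_part H))"
      using f[OF \<open>X \<in> U\<close>] has_derivative_unique by blast
    \<comment> \<open>The difference of the two candidates is symmetric, hence an admissible test
      direction; testing with it shows that its norm is zero.\<close>
    have "S \<bullet> (S - riesz (f' X)) = riesz (f' X) \<bullet> (S - riesz (f' X))"
    proof -
      have "sym_part (S - riesz (f' X)) = S - riesz (f' X)"
        using S f'_Sym3[of X]
        by (simp add: linear_diff[OF bounded_linear.linear[OF bounded_linear_sym_part]])
      then show ?thesis by (simp add: eq frob_eq_inner)
    qed
    then have "(S - riesz (f' X)) \<bullet> (S - riesz (f' X)) = 0"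
      by (subst inner_diff_left) simp
    then show "S = riesz (f' X)"
      by (simp only: inner_eq_zero_iff right_minus_eq)
  qed
  show ?thesis
  proof
    have "((\<lambda>X. riesz (f' X)) has_derivative (\<lambda>H. riesz (f'' H))) (at E)"
      by (rule bounded_linear.has_derivative[OF bounded_linear_riesz f'])
    then show "((\<lambda>X. PK2_stress W (sym_part X)) has_derivative (\<lambda>H. riesz (f'' H))) (at E)"
    \<comment> \<open>Since \<open>f'\<close> depends on \<open>X\<close> only through
      \<open>sym_part X\<close> and the projection is idempotent, both maps agree on all of
      \<open>U\<close>.\<close>
    proof (rule has_derivative_transform_within_open[OF _ \<open>open U\<close> \<open>E \<in> U\<close>])
      show "riesz (f' X) = PK2_stress W (sym_part X)" if "X \<in> U" for X
        using that PK2[of "sym_part X"] by (simp add: U_def f'_def)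
    qed
    show "riesz (f'' X) \<in> Sym3" for X
      by (rule sym3) (simp add: f''_def)
    show "riesz (f'' X) \<bullet> Y = riesz (f'' Y) \<bullet> X" for X Y
      using second_derivative_symmetric[OF \<open>open U\<close> \<open>E \<in> U\<close> f f'] by simp
    show "PK2_stress W E \<in> Sym3"
      using PK2[OF assms(2)] f'_Sym3 by simp
  qed
qed

section \<open>The Zaremba-Jaumann rate and its tangent stiffness\<close>

lemma minor_symmetric_sym_part:
  assumes "minor_symmetric T"
  shows "T (sym_part X) = T X"
proof -
  interpret linear T using assms by (simp add: minor_symmetric_def)
  show ?thesis using assms
    by (simp add: sym_part_def add scale minor_symmetric_def flip: scaleR_2)
qed

lemma ZJ_rate_kirchhoff:
  assumes "((\<lambda>X. PK2_stress W (sym_part X)) has_derivative A) (at (green_lagrange F))"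
    and \<phi>: "(\<phi> has_vector_derivative V) (at t)" and "\<phi> t = F" and "F \<in> GL_pos"
  shows "ZJ_rate \<phi> (\<lambda>s. kirchhoff W (\<phi> s)) t =
    (let D = rate_of_deformation \<phi> t; \<tau> = kirchhoff W F
     in D ** \<tau> + \<tau> ** D + F ** A (transpose F ** D ** F) ** transpose F)"
proof -
  define L D Q S where "L = velocity_gradient \<phi> t" and "D = rate_of_deformation \<phi> t"
    and "Q = vorticity \<phi> t" and "S = PK2_stress W (green_lagrange F)"
  \<comment> \<open>All velocity terms are expressed by the symmetric part \<open>D\<close> and the
    skew part \<open>Q\<close>, so that the cancellation of the vorticity becomes plain matrix
    algebra.\<close>
  have L: "L = D + Q" and LT: "transpose L = D - Q"
    by (simp_all add: L_def D_def Q_def rate_of_deformation_def vorticity_def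
        flip: scaleR_add_right scaleR_diff_right)
  have V: "V = (D + Q) ** F"
  proof -
    have "matrix_inv F ** F = mat 1"
      by (intro matrix_inv_left GL_pos_invertible assms(4))
    moreover have "vector_derivative \<phi> (at t) = V"
      using \<phi> by (rule vector_derivative_at)
    ultimately show ?thesis
      by (simp add: L_def velocity_gradient_def assms(3) flip: L matrix_mul_assoc)
  qed
  have VT: "transpose V = transpose F ** (D - Q)"
    by (simp add: V matrix_transpose_mul LT flip: L)
  note mult = bounded_bilinear.has_vector_derivative[OF bounded_bilinear_matrix_matrix_mult]
  have \<phi>T: "((\<lambda>s. transpose (\<phi> s)) has_vector_derivative transpose V) (at t)"
    by (rule bounded_linear.has_vector_derivative[OF bounded_linear_transpose \<phi>])
  have "((\<lambda>s. green_lagrange (\<phi> s)) has_vector_derivative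
      (1/2) *\<^sub>R ((transpose (\<phi> t) ** V + transpose V ** \<phi> t) - 0)) (at t)"
    unfolding green_lagrange_def
    by (intro bounded_linear.has_vector_derivative[OF bounded_linear_scaleR_right]
        has_vector_derivative_diff mult \<phi> \<phi>T has_vector_derivative_const)
  \<comment> \<open>The contributions of \<open>Q\<close> have opposite signs and cancel; those of
    \<open>D\<close> coincide.\<close>
  also have "(1/2) *\<^sub>R ((transpose (\<phi> t) ** V + transpose V ** \<phi> t) - 0) = transpose F ** D ** F"
    unfolding assms(3) VT unfolding V by (simp add: matrix_mult_distribs matrix_mul_assoc
        flip: scaleR_2)
  finally have E: "((\<lambda>s. green_lagrange (\<phi> s)) has_vector_derivative transpose F ** D ** F) (at t)" .
  interpret A: bounded_linear A
    using assms(1) by (rule has_derivative_bounded_linear)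
  \<comment> \<open>The strain is symmetric at every time, so the projection can be inserted for the
    chain rule and removed afterwards.\<close>
  have "((\<lambda>s. PK2_stress W (sym_part (green_lagrange (\<phi> s)))) has_vector_derivative
      A (transpose F ** D ** F)) (at t)"
    using has_derivative_compose[OF E[unfolded has_vector_derivative_def], of "\<lambda>X. PK2_stress W (sym_part X)" A]
      assms(1,3)
    by (simp add: has_vector_derivative_def A.scaleR)
  then have S: "((\<lambda>s. PK2_stress W (green_lagrange (\<phi> s))) has_vector_derivative
      A (transpose F ** D ** F)) (at t)"
    by (simp add: green_lagrange_in_Sym3)
  have "((\<lambda>s. kirchhoff W (\<phi> s)) has_vector_derivative
      (\<phi> t ** PK2_stress W (green_lagrange (\<phi> t))) ** transpose V +
      (\<phi> t ** A (transpose F ** D ** F) + V ** PK2_stress W (green_lagrange (\<phi> t))) ** transpose (\<phi> t)) (at t)"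
    unfolding kirchhoff_def by (intro mult \<phi> \<phi>T S)
  then have "ZJ_rate \<phi> (\<lambda>s. kirchhoff W (\<phi> s)) t =
      F ** S ** transpose V + (F ** A (transpose F ** D ** F) + V ** S) ** transpose F
      + kirchhoff W F ** Q - Q ** kirchhoff W F"
    by (simp add: ZJ_rate_def vector_derivative_at assms(3) S_def Q_def)
  \<comment> \<open>With \<tau> for \<open>F ** S ** transpose F\<close>, the stress terms are (D +
    Q)\<tau> + \<tau>(D - Q); the corotational terms \<tau>Q - Q\<tau> remove the vorticity.\<close>
  also have "\<dots> = D ** kirchhoff W F + kirchhoff W F ** D + F ** A (transpose F ** D ** F) ** transpose F"
    unfolding VT unfolding V by (simp add: matrix_mult_distribs matrix_mul_assoc kirchhoff_def
        flip: S_def)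
  finally show ?thesis by (simp add: D_def Let_def)
qed

text \<open>The affine curve with velocity \<open>D ** F\<close> has velocity gradient
  \<open>D\<close> at time 0. Its determinant is continuous and so stays positive on a small
  interval around 0.\<close>

lemma motion_with_rate_of_deformation:
  assumes "D \<in> Sym3" "F \<in> GL_pos"
  obtains I \<phi> where "motion I \<phi>" "0 \<in> I" "\<phi> 0 = F" "rate_of_deformation \<phi> 0 = D"
proof -
  define \<phi> where "\<phi> s = F + s *\<^sub>R (D ** F)" for s :: real
  have \<phi>: "(\<phi> has_vector_derivative D ** F) (at s)" for s
    unfolding \<phi>_def by (auto intro!: derivative_eq_intros)
  have "continuous_on UNIV (\<lambda>s. det (\<phi> s))"
    unfolding \<phi>_def by (intro continuous_on_det continuous_intros)
  then have "open {s. 0 < det (\<phi> s)}"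
    by (intro open_Collect_less continuous_on_const)
  moreover have "0 < det (\<phi> 0)"
    using assms(2) by (simp add: \<phi>_def GL_pos_def)
  ultimately obtain e where e: "e > 0" "ball 0 e \<subseteq> {s. 0 < det (\<phi> s)}"
    by (metis (mono_tags, lifting) mem_Collect_eq openE)
  have "F ** matrix_inv F = mat 1"
    by (intro matrix_inv_right GL_pos_invertible assms(2))
  then have "velocity_gradient \<phi> 0 = D"
    using vector_derivative_at[OF \<phi>[of 0]]
    by (simp add: velocity_gradient_def \<phi>_def flip: matrix_mul_assoc)
  then have "rate_of_deformation \<phi> 0 = D"
    using assms(1) by (simp add: rate_of_deformation_def Sym3_def flip: scaleR_2)
  moreover have "motion (ball 0 e) \<phi>"
    using e \<phi> unfolding motion_def C1_differentiable_on_def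
    by (auto simp: is_interval_ball_real GL_pos_def intro!: exI[of _ "\<lambda>s. D ** F"])
  ultimately show ?thesis
    using that[of "ball 0 e" \<phi>] e by (simp add: \<phi>_def)
qed

text \<open>Resolves the definite description: every symmetric matrix is the rate of deformation of
  some motion through \<open>F\<close>, so two candidates agree on \<open>Sym3\<close>, and minor
  symmetry extends this to all matrices.\<close>

lemma ZJ_stiffness_eqI:
  assumes "minor_symmetric H" "F \<in> GL_pos"
    and H: "\<And>I \<phi> t. motion I \<phi> \<Longrightarrow> t \<in> I \<Longrightarrow> \<phi> t = F \<Longrightarrow>
      ZJ_rate \<phi> (\<lambda>s. kirchhoff W (\<phi> s)) t = H (rate_of_deformation \<phi> t)"
  shows "ZJ_stiffness W F = H"
  unfolding ZJ_stiffness_def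
proof (rule the_equality)
  show "minor_symmetric H \<and> (\<forall>I \<phi> t. motion I \<phi> \<and> t \<in> I \<and> \<phi> t = F \<longrightarrow>
      ZJ_rate \<phi> (\<lambda>s. kirchhoff W (\<phi> s)) t = H (rate_of_deformation \<phi> t))"
    using assms by blast
next
  fix H' assume H': "minor_symmetric H' \<and> (\<forall>I \<phi> t. motion I \<phi> \<and> t \<in> I \<and> \<phi> t = F \<longrightarrow>
      ZJ_rate \<phi> (\<lambda>s. kirchhoff W (\<phi> s)) t = H' (rate_of_deformation \<phi> t))"
  have "H' X = H X" for X
  proof -
    obtain I \<phi> where "motion I \<phi>" "0 \<in> I" "\<phi> 0 = F" "rate_of_deformation \<phi> 0 = sym_part X"
      using motion_with_rate_of_deformation[OF sym_part_in_Sym3 assms(2)] .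
    then have "H' (sym_part X) = H (sym_part X)"
      using H' H by metis
    then show ?thesis
      using H' assms(1) by (simp add: minor_symmetric_sym_part)
  qed
  then show "H' = H" by auto
qed

theorem lemma1p2:
  fixes W :: "mat3 \<Rightarrow> real" and F :: mat3
  assumes "C2_energy W" and "F \<in> GL_pos"
  shows "(\<forall>D1\<in>Sym3. \<forall>D2\<in>Sym3.
            frob (ZJ_stiffness W F D1) D2 = frob (ZJ_stiffness W F D2) D1) \<and>
         (\<lambda>X. (1 / det F) *\<^sub>R ZJ_stiffness W F X) \<in> Sym4_6"
proof -
  obtain A where A: "((\<lambda>X. PK2_stress W (sym_part X)) has_derivative A) (at (green_lagrange F))"
    and A_Sym3: "\<And>X. A X \<in> Sym3"
    and A_sym: "\<And>X Y. A X \<bullet> Y = A Y \<bullet> X"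
    and S: "PK2_stress W (green_lagrange F) \<in> Sym3"
    using PK2_stress_derivative[OF assms(1) green_lagrange_in_strain_domain[OF assms(2)]] by blast
  define \<tau> where "\<tau> = kirchhoff W F"
  have \<tau>: "transpose \<tau> = \<tau>"
    using S by (simp add: \<tau>_def kirchhoff_def Sym3_def matrix_transpose_mul matrix_mul_assoc)
  \<comment> \<open>Applying \<open>sym_part\<close> to the argument extends the formula from
    \<open>Sym3\<close> to a minor symmetric tensor on all matrices.\<close>
  define H where "H X = sym_part X ** \<tau> + \<tau> ** sym_part X
      + F ** A (transpose F ** sym_part X ** F) ** transpose F" for X
  interpret A: bounded_linear A
    using A by (rule has_derivative_bounded_linear)
  have minor: "minor_symmetric H"
    unfolding minor_symmetric_def
  proof (intro conjI allI)
    show "linear H"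
      by (rule linearI)
        (simp_all add: H_def A.add A.scaleR matrix_mult_distribs scaleR_add_right
          linear_add[OF bounded_linear.linear[OF bounded_linear_sym_part]]
          linear_scale[OF bounded_linear.linear[OF bounded_linear_sym_part]])
    show "H X \<in> Sym3" for X
      using A_Sym3 by (simp add: H_def Sym3_def transpose_linear_simps matrix_transpose_mul \<tau> matrix_mul_assoc)
    show "H (transpose X) = H X" for X
      by (simp add: H_def)
  qed
  have "ZJ_stiffness W F = H"
  proof (rule ZJ_stiffness_eqI[OF minor assms(2)])
    fix I \<phi> t assume m: "motion I \<phi>" "t \<in> I" and "\<phi> t = F"
    then obtain V where V: "(\<phi> has_vector_derivative V) (at t)"
      unfolding motion_def C1_differentiable_on_def by blast
    have "sym_part (rate_of_deformation \<phi> t) = rate_of_deformation \<phi> t"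
      by (intro sym_part_Sym3)
        (simp add: rate_of_deformation_def Sym3_def transpose_linear_simps add.commute)
    then show "ZJ_rate \<phi> (\<lambda>s. kirchhoff W (\<phi> s)) t = H (rate_of_deformation \<phi> t)"
      using ZJ_rate_kirchhoff[OF A V \<open>\<phi> t = F\<close> assms(2)] by (simp add: H_def \<tau>_def Let_def)
  qed
  moreover have major: "H X \<bullet> Y = H Y \<bullet> X" if "X \<in> Sym3" "Y \<in> Sym3" for X Y
  proof -
    have X: "transpose X = X" and Y: "transpose Y = Y"
      using that by (simp_all add: Sym3_def)
    have 1: "(X ** \<tau>) \<bullet> Y = (Y ** \<tau>) \<bullet> X"
      by (simp add: inner_matrix_mult_right \<tau> inner_commute[of X])
    have 2: "(\<tau> ** X) \<bullet> Y = (\<tau> ** Y) \<bullet> X"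
      by (simp add: inner_matrix_mult_left \<tau> inner_commute[of X])
    \<comment> \<open>The congruence by \<open>F\<close> is the adjoint of the congruence by
      \<open>transpose F\<close>, so self-adjointness of \<open>A\<close> carries over to the
      elastic term.\<close>
    have 3: "(F ** A Z ** transpose F) \<bullet> Y = A Z \<bullet> (transpose F ** Y ** F)" for Z Y
      by (subst inner_matrix_mult_right, subst inner_matrix_mult_left) (simp add: matrix_mul_assoc)
    show ?thesis
      using that by (simp add: H_def inner_add_left 1 2 3 A_sym)
  qed
  moreover have "(\<lambda>X. (1 / det F) *\<^sub>R H X) \<in> Sym4_6"
  proof -
    have "linear (\<lambda>X. (1 / det F) *\<^sub>R H X)"
      using minor by (intro linear_compose_scale_right) (simp add: minor_symmetric_def)
    then show ?thesis
      using minor major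
      by (auto simp: Sym4_6_def minor_symmetric_def major_symmetric_def Sym3_def frob_eq_inner
          transpose_linear_simps)
  qed
  ultimately show ?thesis
    by (simp add: frob_eq_inner)
qed

end
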